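(* Let $S$ be a linear, uniformly convergent interpolatory subdivision scheme reproducing polynomials up to some degree $P$, let $\delta: l^\infty(\mathbb{Z})\to l^\infty(\mathbb{Z})$ be a continuous linear operator, let $F$ be a (possibly nonlinear) operator on $l^\infty(\mathbb{Z})$, and let $S_{NL}$ be the interpolatory subdivision scheme defined for $f\in l^\infty(\mathbb{Z})$, $n\in\mathbb{Z}$ by $$S_{NL}(f)_{2n+1}=S(f)_{2n+1}+F(\delta f)_{2n+1},\qquad S_{NL}(f)_{2n}=f_n .$$ Assume that there are constants $M>0$ and $c<1$ such that for all $f,g,d_1,d_2\in l^\infty(\mathbb{Z})$ $$\|F(d_1)-F(d_2)\|_\infty\le M\|d_1-d_2\|_\infty,$$ $$\|\delta(S_{NL}f-S_{NL}g)\|_\infty\le c\,\|\delta(f-g)\|_\infty .$$ Then the multi-resolution transform associated to $S_{NL}$ is stable, i.e. there exists a constant $C$ such that for all $L\ge 0$, all $f^L,\tilde f^L\in l^\infty(\mathbb{Z})$ with multi-resolution decompositions $\{f^0,d^0,\dots,d^{L-1}\}$ and $\{\tilde f^0,\tilde d^0,\dots,\tilde d^{L-1}\}$, and all $j\le L$: $$\|f^j-\tilde f^j\|_\infty\le C\Big(\|f^0-\tilde f^0\|_\infty+\sum_{k=0}^{j-1}\|d^k-\tilde d^k\|_\infty\Big),$$ $$\|f^0-\tilde f^0\|_\infty\le C\|f^j-\tilde f^j\|_\infty,$$ $$\|d^k-\tilde d^k\|_\infty\le C\|f^j-\tilde f^j\|_\infty\quad\text{for all } 0\le k\le j-1 .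$$
   Context: $l^\infty(\mathbb{Z})$ is the space of bounded real sequences indexed by $\mathbb{Z}$, with the sup norm $\|\cdot\|_\infty$. A subdivision scheme is an operator $T$ on real sequences indexed by $\mathbb{Z}$ mapping $l^\infty(\mathbb{Z})$ to itself; it is interpolatory if $T(f)_{2n}=f_n$ for all $n$. The linear scheme $S$ is a linear operator on real sequences whose restriction to $l^\infty(\mathbb{Z})$ is a continuous operator into $l^\infty(\mathbb{Z})$. Only the odd-index values of $F$ are used in defining $S_{NL}$; by convention $F(d)_{2n}=0$ for all $n$. The interpolatory scheme $S$ reproduces polynomials up to degree $P$ if for every polynomial $\mathcal P$ of degree at most $P$ and every scale $j$: if $f_n=\mathcal P(n2^{-j})$ for all $n$, then $S(f)_{2n+1}=\mathcal P((2n+1)2^{-(j+1)})$ for all $n$. A subdivision scheme $T$ is uniformly convergent if for every $f\in l^\infty(\mathbb{Z})$ there is a continuous function $f^\infty:\mathbb{R}\to\mathbb{R}$ with $\lim_{j\to+\infty}\sup_{n\in\mathbb{Z}}|T^j(f)_n-f^\infty(2^{-j}n)|=0$. Multi-resolution decomposition associated to $S_{NL}$: given $f^L\in l^\infty(\mathbb{Z})$, for $j=L-1,\dots,0$ the coarser sequence $f^j$ is obtained by sub-sampling, $f^j_n=f^{j+1}_{2n}$, and the details are $d^j_n=f^{j+1}_{2n+1}-S_{NL}(f^j)_{2n+1}$. The decomposition of $f^L$ is $\{f^0,d^0,\dots,d^{L-1}\}$, and the intermediate sequences $f^j$, $0\le j\le L$, are those just defined (similarly for $\tilde f^L$).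
   Formalization: In the definition of uniform convergence the limit function f^∞ is additionally required to be bounded; without this the claim fails for general linear S that are not shift-invariant, while for shift-invariant S it is automatic. *)

theory Defs
  imports "HOL-Analysis.Analysis" "HOL-Computational_Algebra.Polynomial"
begin

text \<open>
  The integers carry the discrete topology, so every function on them is continuous and
  \<open>int \<Rightarrow>\<^sub>C real\<close> is the Banach space of bounded real sequences indexed by the integers,
  with the sup norm.
\<close>

type_synonym linf = "int \<Rightarrow>\<^sub>C real"

declare [[coercion "apply_bcontfun :: linf \<Rightarrow> int \<Rightarrow> real"]]

lemma mem_linf_iff: "(f :: int \<Rightarrow> real) \<in> bcontfun \<longleftrightarrow> bounded (range f)"
  by (simp add: bcontfun_def)

lemma mem_linf_reindex:
  fixes h :: "int \<Rightarrow> int"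
  shows "(\<lambda>n. apply_bcontfun (f :: linf) (h n)) \<in> bcontfun"
  unfolding mem_linf_iff
  by (rule bounded_subset[of "range f"]) auto


definition subdivision_scheme :: "((int \<Rightarrow> real) \<Rightarrow> (int \<Rightarrow> real)) \<Rightarrow> bool" where
  "subdivision_scheme T \<longleftrightarrow> (\<forall>f. bounded (range f) \<longrightarrow> bounded (range (T f)))"

definition interpolatory :: "((int \<Rightarrow> real) \<Rightarrow> (int \<Rightarrow> real)) \<Rightarrow> bool" where
  "interpolatory T \<longleftrightarrow> (\<forall>f n. T f (2 * n) = f n)"

text \<open>
  Linearity is required on all sequences, continuity only on the bounded ones. \<open>Bcontfun\<close> is
  only meaningful on bounded sequences, which \<open>subdivision_scheme\<close> guarantees here.
\<close>

definition linear_scheme :: "((int \<Rightarrow> real) \<Rightarrow> (int \<Rightarrow> real)) \<Rightarrow> bool" where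
  "linear_scheme T \<longleftrightarrow> subdivision_scheme T \<and>
     (\<forall>a b f g. T (\<lambda>n. a * f n + b * g n) = (\<lambda>n. a * T f n + b * T g n)) \<and>
     continuous_on UNIV (\<lambda>f :: linf. Bcontfun (T f) :: linf)"

definition reproduces_polynomials :: "((int \<Rightarrow> real) \<Rightarrow> (int \<Rightarrow> real)) \<Rightarrow> nat \<Rightarrow> bool" where
  "reproduces_polynomials T P \<longleftrightarrow>
     (\<forall>(p :: real poly) (j :: int) (f :: int \<Rightarrow> real). degree p \<le> P \<longrightarrow>
        (\<forall>n. f n = poly p (of_int n * 2 powi (- j))) \<longrightarrow>
        (\<forall>n. T f (2 * n + 1) = poly p (of_int (2 * n + 1) * 2 powi (- (j + 1)))))"

text \<open>
  The limit function is a \<^emph>\<open>bounded\<close> continuous function, the continuous counterpart of a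
  bounded sequence. For shift-invariant schemes this is automatic. For an arbitrary linear
  operator it is not: every sequence may then have a continuous limit although the iterates
  are not uniformly bounded in operator norm, i.e. the scheme itself is unstable. An example is
  the interpolatory scheme \<open>T f (2n+1) = f n + a k * (f (n+1) - f n)\<close> for
  \<open>2^k \<le> n < 2^(k+1)\<close>, with \<open>a k = 3\<close> on a sparse union of ever longer
  runs of \<open>k\<close> and \<open>a k = 1/2\<close> otherwise (also for \<open>n \<le> 0\<close>).
\<close>

definition uniformly_convergent_scheme :: "((int \<Rightarrow> real) \<Rightarrow> (int \<Rightarrow> real)) \<Rightarrow> bool" where
  "uniformly_convergent_scheme T \<longleftrightarrow>
     (\<forall>f. bounded (range f) \<longrightarrow>
        (\<exists>finf :: real \<Rightarrow> real. continuous_on UNIV finf \<and> bounded (range finf) \<and>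
           (\<lambda>j :: nat. SUP n :: int. ereal \<bar>(T ^^ j) f n - finf (of_int n / 2 ^ j)\<bar>)
             \<longlonglongrightarrow> 0))"

definition nl_scheme ::
  "((int \<Rightarrow> real) \<Rightarrow> (int \<Rightarrow> real)) \<Rightarrow> (linf \<Rightarrow> linf) \<Rightarrow> (linf \<Rightarrow> linf) \<Rightarrow> linf \<Rightarrow> linf" where
  "nl_scheme S F \<delta> f =
     Bcontfun (\<lambda>m. if even m then f (m div 2) else S f m + F (\<delta> f) m)"

text \<open>The sequence in this definition is indeed bounded, so the defining equations hold.\<close>

lemma nl_scheme_apply:
  assumes "subdivision_scheme S"
  shows "nl_scheme S F \<delta> f m = (if even m then f (m div 2) else S f m + F (\<delta> f) m)"
proof -
  let ?h = "\<lambda>m. if even m then f (m div 2) else S f m + F (\<delta> f) m"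
  have "bounded (range (S f))"
    using assms by (auto simp: subdivision_scheme_def)
  then obtain B where B: "\<And>m. \<bar>S f m\<bar> \<le> B"
    by (auto simp: bounded_iff)
  have "\<bar>?h m\<bar> \<le> norm f + (B + norm (F (\<delta> f)))" for m
    using B[of m] norm_bounded[of f "m div 2"] norm_bounded[of "F (\<delta> f)" m] norm_ge_zero[of f]
      norm_ge_zero[of "F (\<delta> f)"]
    by (auto simp del: norm_ge_zero)
  hence "?h \<in> bcontfun"
    unfolding mem_linf_iff bounded_iff ball_simps real_norm_def by blast
  thus ?thesis
    unfolding nl_scheme_def by (simp add: Bcontfun_inverse)
qed

lemma nl_scheme_even: "subdivision_scheme S \<Longrightarrow> nl_scheme S F \<delta> f (2 * n) = f n"
  by (simp add: nl_scheme_apply)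

lemma nl_scheme_odd:
  "subdivision_scheme S \<Longrightarrow>
     nl_scheme S F \<delta> f (2 * n + 1) = S f (2 * n + 1) + F (\<delta> f) (2 * n + 1)"
  by (simp add: nl_scheme_apply)


definition even_part :: "linf \<Rightarrow> linf" where
  "even_part f = Bcontfun (\<lambda>n. f (2 * n))"

definition odd_part :: "linf \<Rightarrow> linf" where
  "odd_part f = Bcontfun (\<lambda>n. f (2 * n + 1))"

lemma even_part_apply: "even_part f n = f (2 * n)"
  by (simp add: even_part_def Bcontfun_inverse mem_linf_reindex)

lemma odd_part_apply: "odd_part f n = f (2 * n + 1)"
  by (simp add: odd_part_def Bcontfun_inverse mem_linf_reindex)

text \<open>
  For \<open>j \<le> L\<close>, \<open>mr_seq L fL j\<close> is the intermediate sequence at scale \<open>j\<close>, obtained from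
  \<open>fL\<close> by sub-sampling \<open>L - j\<close> times; \<open>mr_detail T L fL j\<close> gives the details at scale
  \<open>j < L\<close>.
\<close>

definition mr_seq :: "nat \<Rightarrow> linf \<Rightarrow> nat \<Rightarrow> linf" where
  "mr_seq L fL j = (even_part ^^ (L - j)) fL"

definition mr_detail :: "(linf \<Rightarrow> linf) \<Rightarrow> nat \<Rightarrow> linf \<Rightarrow> nat \<Rightarrow> linf" where
  "mr_detail T L fL j = odd_part (mr_seq L fL (j + 1)) - odd_part (T (mr_seq L fL j))"

lemma mr_seq_top: "mr_seq L fL L = fL"
  by (simp add: mr_seq_def)

lemma mr_seq_apply: "j < L \<Longrightarrow> mr_seq L fL j n = mr_seq L fL (j + 1) (2 * n)"
  by (simp add: mr_seq_def Suc_diff_Suc[symmetric] even_part_apply)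

lemma mr_detail_apply:
  "mr_detail T L fL j n = mr_seq L fL (j + 1) (2 * n + 1) - T (mr_seq L fL j) (2 * n + 1)"
  by (simp add: mr_detail_def odd_part_apply)

definition mr_stable :: "(linf \<Rightarrow> linf) \<Rightarrow> bool" where
  "mr_stable T \<longleftrightarrow>
     (\<exists>C :: real. \<forall>(L :: nat) (fL :: linf) (gL :: linf). \<forall>j \<le> L.
        norm (mr_seq L fL j - mr_seq L gL j)
          \<le> C * (norm (mr_seq L fL 0 - mr_seq L gL 0)
                 + (\<Sum>k<j. norm (mr_detail T L fL k - mr_detail T L gL k))) \<and>
        norm (mr_seq L fL 0 - mr_seq L gL 0) \<le> C * norm (mr_seq L fL j - mr_seq L gL j) \<and>
        (\<forall>k<j. norm (mr_detail T L fL k - mr_detail T L gL k)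
                 \<le> C * norm (mr_seq L fL j - mr_seq L gL j)))"

end

theory Submission
  imports Defs
begin

text \<open>
  Let \<open>u j\<close> be the difference of the two intermediate sequences \<open>f j\<close> and \<open>g j\<close> at scale \<open>j\<close>,
  let \<open>e j\<close> be the difference of the details, placed at the odd indices, and let \<open>A\<close> be \<open>S\<close> acting on bounded
  sequences. Since \<open>F\<close> vanishes at even indices,
  \<open>u (j+1) = A (u j) + (F (\<delta> (f j)) - F (\<delta> (g j))) + e j\<close>.

  Every orbit of \<open>A\<close> is bounded because \<open>S\<close> converges uniformly to a bounded limit, so by the
  Banach--Steinhaus theorem (\<open>uniform_boundedness\<close>) the powers of \<open>A\<close> have operator norms bounded
  by a common \<open>K\<close>. Hence \<open>\<parallel>u j\<parallel>\<close> is at most \<open>K\<close> times the sum of \<open>\<parallel>u 0\<parallel>\<close> and the norms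
  of all the perturbations (\<open>power_bounded_recurrence\<close>). By the Lipschitz bound on \<open>F\<close>, the one at
  scale \<open>k\<close> has norm at most \<open>M \<parallel>\<delta> (u k)\<parallel> + \<parallel>e k\<parallel>\<close>. The contraction
  hypothesis gives \<open>\<parallel>\<delta> (u (k+1))\<parallel> \<le> c \<parallel>\<delta> (u k)\<parallel> + \<parallel>\<delta>\<parallel> \<parallel>e k\<parallel>\<close>, so
  \<open>(\<Sum>k<j. \<parallel>\<delta> (u k)\<parallel>) \<le> \<parallel>\<delta>\<parallel> / (1 - c) * (\<parallel>u 0\<parallel> + (\<Sum>k<j. \<parallel>e k\<parallel>))\<close>, with a constant independent of
  the number of scales (\<open>contractive_recurrence_sum\<close>). This proves the stability of the
  reconstruction.

  Conversely, sub-sampling does not increase the sup norm, and the details at scale \<open>k\<close> are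
  controlled by the sequences at scales \<open>k\<close> and \<open>k + 1\<close> because the nonlinear scheme is Lipschitz.
\<close>

section \<open>Bounded operators and uniform boundedness\<close>

lemma linear_bounded_near_0:
  fixes A :: "'a::real_normed_vector \<Rightarrow> 'b::real_normed_vector"
  assumes A: "linear A" and r: "r > 0" and B: "\<And>x. norm x < r \<Longrightarrow> norm (A x) \<le> B"
  shows "norm (A x) \<le> (2 * B / r) * norm x"
proof (cases "x = 0")
  case True
  then show ?thesis using linear_0[OF A] by simp
next
  case False
  define t where "t = r / (2 * norm x)"
  have t: "t > 0" using False r by (simp add: t_def)
  have "norm (t *\<^sub>R x) < r" using False r t by (simp add: t_def)
  then have "norm (A (t *\<^sub>R x)) \<le> B" by (rule B)
  then have "t * norm (A x) \<le> B" using t by (simp add: linear_scale[OF A])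
  then show ?thesis using t False r by (simp add: t_def field_simps)
qed

lemma linear_continuous_imp_bounded_linear:
  fixes A :: "'a::real_normed_vector \<Rightarrow> 'b::real_normed_vector"
  assumes A: "linear A" and cont: "continuous_on UNIV A"
  shows "bounded_linear A"
proof -
  have "continuous (at 0) A"
    using cont by (simp add: continuous_on_eq_continuous_at)
  then obtain r where r: "r > 0" "\<And>x. norm x < r \<Longrightarrow> norm (A x) < 1"
    unfolding continuous_at_eps_delta
    by (metis dist_0_norm dist_commute linear_0[OF A] zero_less_one)
  have "norm (A x) \<le> norm x * (2 * 1 / r)" for x
    using linear_bounded_near_0[OF A r(1), of 1 x] r(2) by (simp add: less_imp_le mult.commute)
  with A show ?thesis
    unfolding bounded_linear_def bounded_linear_axioms_def by blast
qed

text \<open>The domain needs a topology only, not a metric, so \<open>linf\<close> is covered.\<close>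

lemma complete_bcontfun:
  "complete (UNIV :: ('a::topological_space \<Rightarrow>\<^sub>C 'b::complete_space) set)"
  unfolding complete_def
proof (intro allI impI)
  fix f :: "nat \<Rightarrow> 'a \<Rightarrow>\<^sub>C 'b"
  assume "(\<forall>n. f n \<in> UNIV) \<and> Cauchy f"
  then obtain g where "uniform_limit UNIV (\<lambda>n. apply_bcontfun (f n)) g sequentially"
    using uniformly_convergent_eq_cauchy[of "\<lambda>_. True" "\<lambda>n. apply_bcontfun (f n)"]
    unfolding Cauchy_def uniform_limit_sequentially_iff
    by (metis dist_fun_lt_imp_dist_val_lt)
  then obtain l where "f \<longlonglongrightarrow> l"
    by (rule uniform_limit_bcontfunE[OF _ sequentially_bot])
  then show "\<exists>l\<in>UNIV. f \<longlonglongrightarrow> l" by (rule bexI) simp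
qed

text \<open>The Banach--Steinhaus theorem for sequences of operators, by Baire's category theorem.
  Completeness is a hypothesis rather than a type class constraint, so that for \<open>linf\<close> it is
  supplied by \<open>complete_bcontfun\<close>.\<close>

theorem uniform_boundedness:
  fixes A :: "nat \<Rightarrow> 'a::real_normed_vector \<Rightarrow> 'b::real_normed_vector"
  assumes complete: "complete (UNIV :: 'a set)"
    and A: "\<And>n. bounded_linear (A n)"
    and pointwise: "\<And>x. \<exists>B. \<forall>n. norm (A n x) \<le> B"
  shows "\<exists>K. \<forall>n x. norm (A n x) \<le> K * norm x"
proof -
  define V where "V k = {x. \<forall>n. norm (A n x) \<le> real k}" for k :: nat
  have closed: "closed (V k)" for k
  proof -
    have "V k = (\<Inter>n. {x. norm (A n x) \<le> real k})"
      by (auto simp: V_def)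
    moreover have "closed {x. norm (A n x) \<le> real k}" for n
      by (intro closed_Collect_le continuous_intros bounded_linear.continuous_on[OF A])
    ultimately show ?thesis by auto
  qed
  have cover: "\<Union>(range V) = UNIV"
  proof -
    have "x \<in> \<Union>(range V)" for x
    proof -
      obtain B where "\<forall>n. norm (A n x) \<le> B" using pointwise by blast
      moreover obtain k :: nat where "B \<le> real k" using real_arch_simple by blast
      ultimately have "x \<in> V k" unfolding V_def using order_trans by blast
      then show ?thesis by blast
    qed
    then show ?thesis by blast
  qed
  have "\<exists>k. interior (V k) \<noteq> {}"
  proof (rule ccontr)
    assume empty: "\<not> ?thesis"
    have "completely_metrizable_space (euclidean :: 'a topology)"
      using Met_TC.completely_metrizable_space_mtopology complete by auto
    moreover have "interior (V k) = {}" for k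
      using empty by blast
    ultimately have "(euclidean :: 'a topology) interior_of \<Union>(range V) = {}"
      using closed
      by (intro Baire_category_alt disjI1) auto
    with cover show False by simp
  qed
  then obtain k a where "a \<in> interior (V k)" by blast
  then obtain r where r: "r > 0" "ball a r \<subseteq> V k"
    by (auto simp: mem_interior)
  have "norm (A n x) \<le> (2 * (2 * real k) / r) * norm x" for n x
  proof (rule linear_bounded_near_0)
    show lin: "linear (A n)" using A bounded_linear.linear by blast
    show "r > 0" by fact
    fix y :: 'a assume "norm y < r"
    then have "a + y \<in> V k" "a \<in> V k"
      using r by (auto simp: dist_norm subset_iff)
    then have "norm (A n (a + y)) \<le> k" "norm (A n a) \<le> k" by (auto simp: V_def)
    moreover have "A n y = A n (a + y) - A n a" by (simp add: linear_add[OF lin])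
    ultimately show "norm (A n y) \<le> 2 * real k"
      using norm_triangle_ineq4[of "A n (a + y)" "A n a"] by simp
  qed
  then show ?thesis by blast
qed

section \<open>Perturbed linear recurrences\<close>

lemma power_bounded_recurrence:
  fixes A :: "'a::real_normed_vector \<Rightarrow> 'a"
  assumes A: "linear A" and K: "\<And>n x. norm ((A ^^ n) x) \<le> K * norm x"
    and u: "\<And>k. k < j \<Longrightarrow> u (Suc k) = A (u k) + b k"
  shows "norm (u j) \<le> K * (norm (u 0) + (\<Sum>k<j. norm (b k)))"
proof -
  have lin: "linear (A ^^ m)" for m
  proof (induction m)
    case 0
    then show ?case by (simp add: linear_iff)
  next
    case (Suc m)
    then show ?case using linear_compose[OF Suc A] by (simp add: comp_def)
  qed
  \<comment> \<open>Bounding all images \<open>(A ^^ m) (u i)\<close> at once keeps the constant \<open>K\<close> from being compounded.\<close>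
  have "norm ((A ^^ m) (u i)) \<le> K * (norm (u 0) + (\<Sum>k<i. norm (b k)))" if "i \<le> j" for i m
    using that
  proof (induction i arbitrary: m)
    case 0
    then show ?case using K by simp
  next
    case (Suc i)
    have "(A ^^ m) (u (Suc i)) = (A ^^ Suc m) (u i) + (A ^^ m) (b i)"
      using u[of i] Suc.prems by (simp add: linear_add[OF lin] funpow_swap1)
    then have "norm ((A ^^ m) (u (Suc i))) \<le> norm ((A ^^ Suc m) (u i)) + norm ((A ^^ m) (b i))"
      by (metis norm_triangle_ineq)
    also have "\<dots> \<le> K * (norm (u 0) + (\<Sum>k<i. norm (b k))) + K * norm (b i)"
      using Suc.IH[of "Suc m"] Suc.prems by (intro add_mono K) (simp del: funpow.simps)
    finally show ?case by (simp add: algebra_simps)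
  qed
  from this[of j 0] show ?thesis by simp
qed

lemma contractive_recurrence_sum:
  fixes s e :: "nat \<Rightarrow> real"
  assumes c: "c < 1" and s_nonneg: "\<And>k. 0 \<le> s k"
    and s: "\<And>k. k < j \<Longrightarrow> s (Suc k) \<le> c * s k + D * e k"
  shows "(\<Sum>k<j. s k) \<le> (s 0 + D * (\<Sum>k<j. e k)) / (1 - c)"
proof -
  \<comment> \<open>With the extra term \<open>s i\<close> the induction step is linear and needs no sign of \<open>c\<close> or \<open>D\<close>.\<close>
  have "s i + (1 - c) * (\<Sum>k<i. s k) \<le> s 0 + D * (\<Sum>k<i. e k)" if "i \<le> j" for i
    using that
  proof (induction i)
    case (Suc i)
    then show ?case using s[of i] by (simp add: algebra_simps)
  qed simp
  from this[of j] s_nonneg[of j] have "(1 - c) * (\<Sum>k<j. s k) \<le> s 0 + D * (\<Sum>k<j. e k)"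
    by simp
  with c show ?thesis by (simp add: field_simps)
qed

section \<open>Convergent schemes are power bounded\<close>

text \<open>The restriction of a subdivision scheme to bounded sequences. Like \<open>Bcontfun\<close>, it is
  meaningful only if \<open>T\<close> maps bounded sequences to bounded ones.\<close>

definition linf_op :: "((int \<Rightarrow> real) \<Rightarrow> (int \<Rightarrow> real)) \<Rightarrow> linf \<Rightarrow> linf" where
  "linf_op T f = Bcontfun (T f)"

lemma linf_op_apply:
  assumes "subdivision_scheme T"
  shows "apply_bcontfun (linf_op T f) = T f"
proof -
  have "bounded (range (apply_bcontfun f))" using apply_bcontfun[of f] by (simp add: mem_linf_iff)
  then have "T f \<in> bcontfun"
    using assms by (simp add: subdivision_scheme_def mem_linf_iff)
  then show ?thesis by (simp add: linf_op_def Bcontfun_inverse)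
qed

lemma linf_op_funpow:
  assumes "subdivision_scheme T"
  shows "apply_bcontfun ((linf_op T ^^ n) f) = (T ^^ n) f"
  by (induction n) (simp_all add: linf_op_apply[OF assms])

lemma bounded_linear_linf_op:
  assumes "linear_scheme T"
  shows "bounded_linear (linf_op T)"
proof (rule linear_continuous_imp_bounded_linear)
  have sub: "subdivision_scheme T"
    and lin: "\<And>a b f g. T (\<lambda>n. a * f n + b * g n) = (\<lambda>n. a * T f n + b * T g n)"
    and cont: "continuous_on UNIV (\<lambda>f :: linf. Bcontfun (T f) :: linf)"
    using assms by (auto simp: linear_scheme_def)
  show "continuous_on UNIV (linf_op T)"
    using cont by (simp add: linf_op_def[abs_def])
  show "linear (linf_op T)"
  proof (rule linearI)
    fix f g :: linf and a :: real
    show "linf_op T (f + g) = linf_op T f + linf_op T g"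
      using lin[of 1 f 1 g] by (intro bcontfun_eqI) (simp add: linf_op_apply[OF sub])
    show "linf_op T (a *\<^sub>R f) = a *\<^sub>R linf_op T f"
      using lin[of a f 0 f] by (intro bcontfun_eqI) (simp add: linf_op_apply[OF sub])
  qed
qed

lemma uniformly_convergent_orbit_bounded:
  assumes sub: "subdivision_scheme T" and conv: "uniformly_convergent_scheme T"
  shows "\<exists>B. \<forall>n. norm ((linf_op T ^^ n) f) \<le> B"
proof -
  have "bounded (range (apply_bcontfun f))" using apply_bcontfun[of f] by (simp add: mem_linf_iff)
  then obtain finf :: "real \<Rightarrow> real" where bdd: "bounded (range finf)"
    and lim: "(\<lambda>j :: nat. SUP n :: int. ereal \<bar>(T ^^ j) f n - finf (of_int n / 2 ^ j)\<bar>)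
             \<longlonglongrightarrow> 0"
    using conv unfolding uniformly_convergent_scheme_def by blast
  obtain B where B: "\<And>x. \<bar>finf x\<bar> \<le> B"
    using bdd by (auto simp: bounded_iff)
  have "\<forall>\<^sub>F j in sequentially.
      (SUP n :: int. ereal \<bar>(T ^^ j) f n - finf (of_int n / 2 ^ j)\<bar>) < 1"
    using lim by (rule order_tendstoD) simp
  then obtain J where J: "\<And>j. j \<ge> J \<Longrightarrow>
      (SUP n :: int. ereal \<bar>(T ^^ j) f n - finf (of_int n / 2 ^ j)\<bar>) < 1"
    unfolding eventually_sequentially by blast
  have tail: "norm ((linf_op T ^^ j) f) \<le> B + 1" if "j \<ge> J" for j
  proof (rule norm_bound)
    fix n :: int
    have "ereal \<bar>(T ^^ j) f n - finf (of_int n / 2 ^ j)\<bar>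
        \<le> (SUP n :: int. ereal \<bar>(T ^^ j) f n - finf (of_int n / 2 ^ j)\<bar>)"
      by (rule SUP_upper) simp
    also have "\<dots> < 1" using J that by blast
    finally have "\<bar>(T ^^ j) f n - finf (of_int n / 2 ^ j)\<bar> < 1" by simp
    with B[of "of_int n / 2 ^ j"] show "norm ((linf_op T ^^ j) f n) \<le> B + 1"
      by (simp add: linf_op_funpow[OF sub])
  qed
  have "norm ((linf_op T ^^ j) f) \<le> Max (insert (B + 1) ((\<lambda>i. norm ((linf_op T ^^ i) f)) ` {..<J}))"
    for j
  proof (cases "j < J")
    case True
    then show ?thesis by (intro Max_ge) auto
  next
    case False
    then have "norm ((linf_op T ^^ j) f) \<le> B + 1" using tail by simp
    also have "\<dots> \<le> Max (insert (B + 1) ((\<lambda>i. norm ((linf_op T ^^ i) f)) ` {..<J}))"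
      by (intro Max_ge) auto
    finally show ?thesis .
  qed
  then show ?thesis by blast
qed

lemma uniformly_convergent_power_bounded:
  assumes lin: "linear_scheme T" and conv: "uniformly_convergent_scheme T"
  shows "\<exists>K. \<forall>n f. norm ((linf_op T ^^ n) f) \<le> K * norm f"
proof (rule uniform_boundedness[where A = "\<lambda>n. linf_op T ^^ n"])
  show "complete (UNIV :: linf set)" by (rule complete_bcontfun)
  show "bounded_linear (linf_op T ^^ n)" for n
  proof (induction n)
    case 0
    then show ?case by (simp add: id_def)
  next
    case (Suc n)
    then show ?case
      using bounded_linear_compose[OF bounded_linear_linf_op[OF lin]] by (simp add: comp_def)
  qed
  show "\<exists>B. \<forall>n. norm ((linf_op T ^^ n) f) \<le> B" for f
    using uniformly_convergent_orbit_bounded[OF _ conv] lin by (simp add: linear_scheme_def)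
qed

section \<open>Multi-resolution sequences and details\<close>

text \<open>The values of \<open>F\<close> at even indices being zero, the perturbation needs no restriction to odd
  indices.\<close>

lemma nl_scheme_diff:
  fixes F \<delta> :: "linf \<Rightarrow> linf"
  assumes lin: "linear_scheme S" and interp: "interpolatory S"
    and F_even: "\<And>(d :: linf) (n :: int). F d (2 * n) = 0"
  shows "nl_scheme S F \<delta> f - nl_scheme S F \<delta> g
    = linf_op S (f - g) + (F (\<delta> f) - F (\<delta> g))"
proof (rule bcontfun_eqI)
  have sub: "subdivision_scheme S" using lin by (simp add: linear_scheme_def)
  fix m :: int
  have diff: "linf_op S (f - g) = linf_op S f - linf_op S g"
    by (rule linear_diff[OF bounded_linear.linear[OF bounded_linear_linf_op[OF lin]]])
  show "apply_bcontfun (nl_scheme S F \<delta> f - nl_scheme S F \<delta> g) m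
    = apply_bcontfun (linf_op S (f - g) + (F (\<delta> f) - F (\<delta> g))) m"
  proof (cases "even m")
    case True
    then obtain n where "m = 2 * n" by blast
    then show ?thesis
      using interp F_even
      by (simp add: diff nl_scheme_apply[OF sub] linf_op_apply[OF sub] interpolatory_def)
  next
    case False
    then show ?thesis by (simp add: diff nl_scheme_apply[OF sub] linf_op_apply[OF sub])
  qed
qed

lemma norm_even_part_diff_le: "norm (even_part f - even_part g) \<le> norm (f - g)"
  using norm_bounded[of "f - g"] by (intro norm_bound) (simp add: even_part_apply)

lemma norm_mr_seq_diff_mono:
  assumes "i \<le> j" "j \<le> L"
  shows "norm (mr_seq L f i - mr_seq L g i) \<le> norm (mr_seq L f j - mr_seq L g j)"
  using assms
proof (induction rule: inc_induct)
  case (step i)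
  have "mr_seq L h i = even_part (mr_seq L h (Suc i))" for h
    using step by (intro bcontfun_eqI) (simp add: even_part_apply mr_seq_apply)
  then show ?case using norm_even_part_diff_le step order_trans by metis
qed simp

text \<open>For an interpolatory \<open>T\<close>, the prediction errors vanish at even indices and are the details at
  odd indices; hence the two differences have the same norm.\<close>

lemma norm_mr_detail_diff:
  fixes T :: "linf \<Rightarrow> linf"
  assumes even: "\<And>h n. T h (2 * n) = h n" and k: "k < L"
  shows "norm (mr_detail T L f k - mr_detail T L g k)
    = norm ((mr_seq L f (Suc k) - T (mr_seq L f k)) - (mr_seq L g (Suc k) - T (mr_seq L g k)))"
    (is "norm ?d = norm ?e")
proof (rule antisym)
  have odd: "?e (2 * n + 1) = ?d n" for n
    by (simp add: mr_detail_apply)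
  show "norm ?d \<le> norm ?e"
    by (rule norm_bound) (metis norm_bounded odd)
  show "norm ?e \<le> norm ?d"
  proof (rule norm_bound)
    fix m :: int
    show "norm (?e m) \<le> norm ?d"
    proof (cases "even m")
      case True
      then obtain n where "m = 2 * n" by blast
      then have "?e m = 0" using k by (simp add: even mr_seq_apply)
      then show ?thesis by simp
    next
      case False
      then obtain n where "m = 2 * n + 1" by (auto elim: oddE)
      then show ?thesis using norm_bounded[of ?d n] odd[of n] by simp
    qed
  qed
qed

section \<open>Stability\<close>

theorem theorem2:
  fixes S :: "(int \<Rightarrow> real) \<Rightarrow> (int \<Rightarrow> real)"
    and \<delta> F :: "linf \<Rightarrow> linf"
    and P :: nat
    and M c :: real
  assumes S_linear: "linear_scheme S"
    and S_convergent: "uniformly_convergent_scheme S"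
    and S_interpolatory: "interpolatory S"
    and S_polynomials: "reproduces_polynomials S P"
    and \<delta>_linear: "linear \<delta>"
    and \<delta>_continuous: "continuous_on UNIV \<delta>"
    and F_even: "\<And>(d :: linf) (n :: int). F d (2 * n) = 0"
    and M_pos: "M > 0"
    and c_less: "c < 1"
    and F_lipschitz: "\<And>d1 d2 :: linf. norm (F d1 - F d2) \<le> M * norm (d1 - d2)"
    and contraction: "\<And>f g :: linf.
      norm (\<delta> (nl_scheme S F \<delta> f - nl_scheme S F \<delta> g)) \<le> c * norm (\<delta> (f - g))"
  shows "mr_stable (nl_scheme S F \<delta>)"
proof -
  have sub: "subdivision_scheme S" using S_linear by (simp add: linear_scheme_def)
  define T where "T = nl_scheme S F \<delta>"
  define A where "A = linf_op S"
  have A: "bounded_linear A" unfolding A_def by (rule bounded_linear_linf_op[OF S_linear])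
  have \<delta>: "bounded_linear \<delta>"
    by (rule linear_continuous_imp_bounded_linear[OF \<delta>_linear \<delta>_continuous])
  obtain K0 where "\<And>n f. norm ((A ^^ n) f) \<le> K0 * norm f"
    unfolding A_def using uniformly_convergent_power_bounded[OF S_linear S_convergent] by blast
  then obtain K where K: "\<And>n f. norm ((A ^^ n) f) \<le> K * norm f" and K_pos: "K \<ge> 0"
    by (metis abs_ge_self abs_ge_zero mult_right_mono norm_ge_zero order_trans)
  obtain D where D: "\<And>f. norm (\<delta> f) \<le> D * norm f" and D_pos: "D \<ge> 0"
    using bounded_linear.nonneg_bounded[OF \<delta>] by (metis mult.commute)
  have T_even: "T h (2 * n) = h n" for h n
    unfolding T_def by (rule nl_scheme_even[OF sub])
  have T_diff: "T f - T g = A (f - g) + (F (\<delta> f) - F (\<delta> g))" for f g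
    unfolding T_def A_def by (rule nl_scheme_diff[OF S_linear S_interpolatory F_even])
  have F_diff: "norm (F (\<delta> f) - F (\<delta> g)) \<le> M * norm (\<delta> (f - g))" for f g
    using F_lipschitz[of "\<delta> f" "\<delta> g"] by (simp add: linear_diff[OF \<delta>_linear])
  \<comment> \<open>\<open>C1\<close> is the constant of the reconstruction, \<open>C2\<close> that of the decomposition.\<close>
  define C1 where "C1 = K * (1 + M * D / (1 - c))"
  define C2 where "C2 = 1 + K + M * D"
  define C where "C = max C1 C2"
  have T_lipschitz: "norm (T f - T g) \<le> (K + M * D) * norm (f - g)" for f g
  proof -
    have "norm (A (f - g)) \<le> K * norm (f - g)" using K[of 1] by simp
    moreover have "norm (F (\<delta> f) - F (\<delta> g)) \<le> M * (D * norm (f - g))"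
      using F_diff D M_pos by (meson mult_left_mono less_imp_le order_trans)
    ultimately show ?thesis
      unfolding T_diff by (intro norm_triangle_le) (simp add: algebra_simps)
  qed
  have "norm (mr_seq L fL j - mr_seq L gL j)
          \<le> C * (norm (mr_seq L fL 0 - mr_seq L gL 0)
                 + (\<Sum>k<j. norm (mr_detail T L fL k - mr_detail T L gL k)))" (is ?th1)
    and "norm (mr_seq L fL 0 - mr_seq L gL 0) \<le> C * norm (mr_seq L fL j - mr_seq L gL j)" (is ?th2)
    and "\<forall>k<j. norm (mr_detail T L fL k - mr_detail T L gL k)
                 \<le> C * norm (mr_seq L fL j - mr_seq L gL j)" (is ?th3)
    if j: "j \<le> L" for L j :: nat and fL gL :: linf
  proof -
    define f where "f = mr_seq L fL"
    define g where "g = mr_seq L gL"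
    define u where "u k = f k - g k" for k
    define p where "p k = F (\<delta> (f k)) - F (\<delta> (g k))" for k
    define e where "e k = (f (Suc k) - T (f k)) - (g (Suc k) - T (g k))" for k
    define E where "E = (\<Sum>k<j. norm (e k))"
    have E_pos: "E \<ge> 0" by (simp add: E_def sum_nonneg)
    have detail: "norm (mr_detail T L fL k - mr_detail T L gL k) = norm (e k)" if "k < j" for k
      unfolding e_def f_def g_def using that j by (intro norm_mr_detail_diff T_even) auto
    have mono: "norm (u i) \<le> norm (u k)" if "i \<le> k" "k \<le> j" for i k
      unfolding u_def f_def g_def using that j by (intro norm_mr_seq_diff_mono) auto
    have u_A: "u (Suc k) = A (u k) + (p k + e k)" for k
      using T_diff[of "f k" "g k"] by (simp add: u_def p_def e_def algebra_simps)
    have u_T: "u (Suc k) = (T (f k) - T (g k)) + e k" for k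
      by (simp add: u_def e_def)
    have "norm (\<delta> (u (Suc k))) \<le> c * norm (\<delta> (u k)) + D * norm (e k)" for k
      unfolding u_T linear_add[OF \<delta>_linear]
      using contraction[of "f k" "g k"] D[of "e k"]
      by (intro norm_triangle_le add_mono) (simp_all add: u_def T_def)
    then have "(\<Sum>k<j. norm (\<delta> (u k))) \<le> (norm (\<delta> (u 0)) + D * E) / (1 - c)"
      unfolding E_def by (intro contractive_recurrence_sum[OF c_less]) auto
    also have "\<dots> \<le> (D * norm (u 0) + D * E) / (1 - c)"
      using c_less D[of "u 0"] by (intro divide_right_mono) auto
    finally have \<delta>_sum: "(\<Sum>k<j. norm (\<delta> (u k))) \<le> D / (1 - c) * (norm (u 0) + E)"
      by (simp add: algebra_simps)
    have "norm (p k + e k) \<le> M * norm (\<delta> (u k)) + norm (e k)" for k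
      using F_diff[of "f k" "g k"] by (intro norm_triangle_le) (simp add: u_def p_def)
    then have "(\<Sum>k<j. norm (p k + e k)) \<le> M * (\<Sum>k<j. norm (\<delta> (u k))) + E"
      unfolding E_def sum_distrib_left sum.distrib[symmetric] by (intro sum_mono)
    also have "\<dots> \<le> M * (D / (1 - c) * (norm (u 0) + E)) + E"
      using mult_left_mono[OF \<delta>_sum less_imp_le[OF M_pos]] by simp
    finally have pert: "norm (u 0) + (\<Sum>k<j. norm (p k + e k))
        \<le> (1 + M * D / (1 - c)) * (norm (u 0) + E)"
      by (simp add: algebra_simps)
    have "norm (u j) \<le> K * (norm (u 0) + (\<Sum>k<j. norm (p k + e k)))"
      using bounded_linear.linear[OF A] K
      by (rule power_bounded_recurrence) (rule u_A)
    also have "\<dots> \<le> C1 * (norm (u 0) + E)"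
      unfolding C1_def mult.assoc using pert K_pos by (simp add: mult_left_mono)
    also have "\<dots> \<le> C * (norm (u 0) + E)"
      using E_pos by (intro mult_right_mono) (auto simp: C_def)
    finally show ?th1
      using detail by (simp add: E_def u_def f_def g_def)
    have C2_C: "C2 * norm (u j) \<le> C * norm (u j)"
      by (intro mult_right_mono) (auto simp: C_def)
    have nonneg: "K + M * D \<ge> 0" using K_pos M_pos D_pos by simp
    have "norm (u 0) \<le> C2 * norm (u j)"
      using mono[of 0 j] mult_nonneg_nonneg[OF nonneg norm_ge_zero[of "u j"]]
      by (simp add: C2_def algebra_simps)
    with C2_C show ?th2
      by (simp add: u_def f_def g_def)
    have "norm (e k) \<le> C2 * norm (u j)" if "k < j" for k
    proof -
      have "norm (e k) \<le> norm (u (Suc k)) + norm (T (f k) - T (g k))"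
        using norm_triangle_ineq4[of "u (Suc k)" "T (f k) - T (g k)"] by (simp add: u_T)
      also have "\<dots> \<le> norm (u j) + (K + M * D) * norm (u j)"
        using mono[of "Suc k" j] mono[of k j] that T_lipschitz[of "f k" "g k"]
          mult_left_mono[OF _ nonneg, of "norm (u k)" "norm (u j)"]
        by (intro add_mono) (auto simp: u_def)
      finally show ?thesis by (simp add: C2_def algebra_simps)
    qed
    with C2_C detail show ?th3
      unfolding u_def f_def g_def by fastforce
  qed
  then show ?thesis
    unfolding mr_stable_def T_def[symmetric] by blast
qed

end
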